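(* Let $\|\cdot\|$ be a symmetric norm on $\mathbb{M}_n$ and let $p\in(0,1)$ and $q\in(-\infty,0)$ with $1/p+1/q=1$. Then, for every $A,B\in\mathbb{M}_n^+$, $$\|AB\|\ge\|A^p\|^{1/p}\,\|B^q\|^{1/q}.$$
   Context: $\mathbb{M}_n$ is the algebra of $n\times n$ complex matrices and $\mathbb{M}_n^+$ the set of its positive semidefinite matrices. A symmetric norm on $\mathbb{M}_n$ is a unitarily invariant norm. For $q<0$, the functional $B\mapsto\|B^q\|^{1/q}$ on $\mathbb{M}_n^+$ is understood to take the value $0$ when $B$ is not invertible. *)

theory Defs
  imports "HOL-Analysis.Analysis"
begin

definition cadjoint :: "complex^'n^'n \<Rightarrow> complex^'n^'n" where
  "cadjoint A = (\<chi> i j. cnj (A $ j $ i))"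

definition unitary_mat :: "complex^'n^'n \<Rightarrow> bool" where
  "unitary_mat U \<longleftrightarrow> cadjoint U ** U = mat 1 \<and> U ** cadjoint U = mat 1"

definition real_diag :: "('n \<Rightarrow> real) \<Rightarrow> complex^'n^'n" where
  "real_diag d = (\<chi> i j. if i = j then of_real (d i) else 0)"

definition psd :: "complex^'n^'n \<Rightarrow> bool" where
  "psd A \<longleftrightarrow> cadjoint A = A \<and>
     (\<forall>x :: complex^'n. 0 \<le> Re (\<Sum>i\<in>UNIV. cnj (x $ i) * (A *v x) $ i))"

definition symmetric_norm :: "(complex^'n^'n \<Rightarrow> real) \<Rightarrow> bool" where
  "symmetric_norm N \<longleftrightarrow>
     (\<forall>X. 0 \<le> N X) \<and>
     (\<forall>X. N X = 0 \<longleftrightarrow> X = 0) \<and>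
     (\<forall>c X. N (\<chi> i j. c * X $ i $ j) = cmod c * N X) \<and>
     (\<forall>X Y. N (X + Y) \<le> N X + N Y) \<and>
     (\<forall>U V X. unitary_mat U \<and> unitary_mat V \<longrightarrow> N (U ** X ** V) = N X)"

text \<open>
  Functional calculus of a Hermitian matrix: \<open>f(U diag(d) U\<^sup>*) = U diag(f \<circ> d) U\<^sup>*\<close>.
  By lemma \<open>herm_fun_diag\<close> below the right-hand side does not depend on the diagonalisation;
  on matrices that are not Hermitian the value is unspecified.
\<close>
definition herm_fun :: "(real \<Rightarrow> real) \<Rightarrow> complex^'n^'n \<Rightarrow> complex^'n^'n" where
  "herm_fun f A = (THE X. \<exists>U d. unitary_mat U \<and>
     A = U ** real_diag d ** cadjoint U \<and>
     X = U ** real_diag (\<lambda>i. f (d i)) ** cadjoint U)"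

lemma real_diag_mult_right: "(W ** real_diag d) $ i $ j = W $ i $ j * of_real (d j)"
  by (simp add: matrix_matrix_mult_def real_diag_def if_distrib cong: if_cong)

lemma real_diag_mult_left: "(real_diag d ** W) $ i $ j = of_real (d i) * W $ i $ j"
  by (simp add: matrix_matrix_mult_def real_diag_def if_distrib[of "\<lambda>x. x * y" for y] cong: if_cong)

lemma herm_fun_unique:
  assumes U: "unitary_mat U" and V: "unitary_mat V"
    and eq: "U ** real_diag d ** cadjoint U = V ** real_diag e ** cadjoint V"
  shows "U ** real_diag (\<lambda>i. f (d i)) ** cadjoint U = V ** real_diag (\<lambda>i. f (e i)) ** cadjoint V"
proof -
  define W where "W = cadjoint V ** U"
  have u: "cadjoint U ** U = mat 1" "U ** cadjoint U = mat 1"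
    and v: "cadjoint V ** V = mat 1" "V ** cadjoint V = mat 1"
    using U V by (auto simp: unitary_mat_def)
  have "cadjoint V ** (U ** real_diag d ** cadjoint U) ** U
      = cadjoint V ** (V ** real_diag e ** cadjoint V) ** U"
    by (simp add: eq)
  moreover have "cadjoint V ** (U ** real_diag d ** cadjoint U) ** U
      = W ** real_diag d ** (cadjoint U ** U)"
    by (simp add: W_def matrix_mul_assoc)
  moreover have "cadjoint V ** (V ** real_diag e ** cadjoint V) ** U
      = (cadjoint V ** V) ** real_diag e ** W"
    by (simp add: W_def matrix_mul_assoc)
  ultimately have W: "W ** real_diag d = real_diag e ** W"
    by (simp add: u v)
  have "W $ i $ j * of_real (f (d j)) = of_real (f (e i)) * W $ i $ j" for i j
  proof -
    have "W $ i $ j * of_real (d j) = of_real (e i) * W $ i $ j"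
      by (metis W real_diag_mult_right real_diag_mult_left)
    then have "W $ i $ j = 0 \<or> e i = d j" by auto
    then show ?thesis by auto
  qed
  then have Wf: "W ** real_diag (\<lambda>i. f (d i)) = real_diag (\<lambda>i. f (e i)) ** W"
    by (simp add: vec_eq_iff real_diag_mult_right real_diag_mult_left)
  have VW: "V ** W = U"
    by (simp add: W_def matrix_mul_assoc v)
  have WU: "W ** cadjoint U = cadjoint V"
    by (simp add: W_def flip: matrix_mul_assoc) (simp add: u)
  have "U ** real_diag (\<lambda>i. f (d i)) ** cadjoint U
      = V ** (W ** real_diag (\<lambda>i. f (d i))) ** cadjoint U"
    by (simp add: VW matrix_mul_assoc)
  also have "\<dots> = V ** real_diag (\<lambda>i. f (e i)) ** (W ** cadjoint U)"
    by (simp add: Wf matrix_mul_assoc)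
  finally show ?thesis by (simp add: WU)
qed

lemma herm_fun_diag:
  assumes "unitary_mat U" and "A = U ** real_diag d ** cadjoint U"
  shows "herm_fun f A = U ** real_diag (\<lambda>i. f (d i)) ** cadjoint U"
  unfolding herm_fun_def
proof (rule the_equality)
  show "\<exists>V e. unitary_mat V \<and> A = V ** real_diag e ** cadjoint V \<and>
      U ** real_diag (\<lambda>i. f (d i)) ** cadjoint U = V ** real_diag (\<lambda>i. f (e i)) ** cadjoint V"
    using assms by blast
next
  fix X
  assume "\<exists>V e. unitary_mat V \<and> A = V ** real_diag e ** cadjoint V \<and>
      X = V ** real_diag (\<lambda>i. f (e i)) ** cadjoint V"
  then obtain V e where "unitary_mat V" "A = V ** real_diag e ** cadjoint V"
      and X: "X = V ** real_diag (\<lambda>i. f (e i)) ** cadjoint V"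
    by blast
  then have "U ** real_diag (\<lambda>i. f (d i)) ** cadjoint U
      = V ** real_diag (\<lambda>i. f (e i)) ** cadjoint V"
    using assms herm_fun_unique[of U V d e f] by simp
  then show "X = U ** real_diag (\<lambda>i. f (d i)) ** cadjoint U"
    using X by simp
qed

text \<open>
  The power of a positive semidefinite matrix. For a negative exponent it is meant for invertible
  matrices only (\<open>0 powr r = 0\<close> would otherwise give the power on the range).
\<close>
definition psd_powr :: "complex^'n^'n \<Rightarrow> real \<Rightarrow> complex^'n^'n" where
  "psd_powr A r = herm_fun (\<lambda>t. t powr r) A"

text \<open>
  The functional \<open>B \<mapsto> N(B\<^sup>r)\<^bsup>1/r\<^esup>\<close>; for \<open>r < 0\<close> it vanishes by convention when
  \<open>B\<close> is not invertible.
\<close>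
definition power_functional :: "(complex^'n^'n \<Rightarrow> real) \<Rightarrow> real \<Rightarrow> complex^'n^'n \<Rightarrow> real" where
  "power_functional N r B =
     (if r < 0 \<and> \<not> invertible B then 0 else N (psd_powr B r) powr (1 / r))"

end

theory Submission
  imports Defs
begin

text \<open>
  The claim concerns invertible \<open>B\<close> only, the right-hand side being \<open>0\<close> otherwise. It is
  equivalent to \<open>N(A\<^sup>p) \<le> c\<close> with \<open>c = \<alpha>\<^sup>p \<beta>\<^bsup>1-p\<^esup>\<close>, \<open>\<alpha> = N(A B)\<close> and \<open>\<beta> = N(B\<^sup>q)\<close>.
  This bound can be read off from diagonals, once a unitary conjugation has moved to an orthonormal
  basis of eigenvectors of \<open>A\<close>.

  In that basis \<open>A = diag(a)\<close>, while the diagonals of \<open>B\<close> and \<open>B\<^sup>q\<close> are averages of the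
  eigenvalues \<open>l\<close> of \<open>B\<close> and of their powers \<open>l\<^sup>q\<close>, with the same doubly stochastic weights
  \<open>\<bar>W\<^sub>i\<^sub>j\<bar>\<^sup>2\<close>. Because \<open>p + q (1 - p) = 0\<close>, one has \<open>a\<^sup>p = (a l)\<^sup>p (l\<^sup>q)\<^bsup>1-p\<^esup>\<close> for every
  \<open>l > 0\<close>, and the weighted arithmetic-geometric mean inequality gives
  \<open>a\<^sup>p \<le> c (p/\<alpha> (a l) + (1-p)/\<beta> l\<^sup>q)\<close> (lemma \<open>reverse_young\<close>). This bound is linear in
  \<open>l\<close> and \<open>l\<^sup>q\<close>, so averaging over the eigenvalues of \<open>B\<close> yields that \<open>A\<^sup>p\<close> is dominated
  entrywise by the diagonal of \<open>M = c (p/\<alpha> A B + (1-p)/\<beta> B\<^sup>q)\<close>. A symmetric norm is monotone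
  on nonnegative diagonal matrices and does not increase when the off-diagonal part is deleted
  (lemma \<open>symmetric_norm_real_diag_le\<close>), whence \<open>N(A\<^sup>p) \<le> N(M) \<le> c (p + (1-p)) = c\<close> by the
  triangle inequality.

  The eigenbases come from the spectral theorem for Hermitian matrices, which is derived here
  by extending an orthonormal family of eigenvectors one vector at a time.
\<close>

section \<open>Adjoints and unitary matrices\<close>

lemma cadjoint_mult: "cadjoint (X ** Y) = cadjoint Y ** cadjoint X"
  by (simp add: cadjoint_def matrix_matrix_mult_def vec_eq_iff mult.commute)

lemma cadjoint_cadjoint [simp]: "cadjoint (cadjoint X) = X"
  by (simp add: cadjoint_def vec_eq_iff)

lemma unitary_mat_cadjoint: "unitary_mat U \<Longrightarrow> unitary_mat (cadjoint U)"
  by (auto simp: unitary_mat_def)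

lemma unitary_mat_1: "unitary_mat (mat 1)"
proof -
  have "cadjoint (mat 1) = (mat 1 :: complex^'n^'n)"
    by (auto simp: cadjoint_def mat_def vec_eq_iff)
  then show ?thesis
    by (simp add: unitary_mat_def)
qed

lemma unitary_mat_mult:
  assumes "unitary_mat U" and "unitary_mat V"
  shows "unitary_mat (U ** V)"
proof -
  have "cadjoint (U ** V) ** (U ** V) = cadjoint V ** (cadjoint U ** U) ** V"
    "(U ** V) ** cadjoint (U ** V) = U ** (V ** cadjoint V) ** cadjoint U"
    by (simp_all add: cadjoint_mult matrix_mul_assoc)
  with assms show ?thesis
    by (simp add: unitary_mat_def)
qed

lemma unitary_mat_cancel:
  assumes "unitary_mat U"
  shows "cadjoint U ** (U ** X) = X" and "U ** (cadjoint U ** X) = X"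
    and "cadjoint U ** U = mat 1" and "U ** cadjoint U = mat 1"
  using assms by (simp_all add: unitary_mat_def matrix_mul_assoc)

lemma unitary_mat_row_norm:
  assumes "unitary_mat W"
  shows "(\<Sum>j\<in>UNIV. (cmod (W $ i $ j))\<^sup>2) = 1"
proof -
  have "complex_of_real (\<Sum>j\<in>UNIV. (cmod (W $ i $ j))\<^sup>2) = (W ** cadjoint W) $ i $ i"
    by (simp add: matrix_matrix_mult_def cadjoint_def flip: complex_norm_square)
  also have "\<dots> = of_real 1"
    using assms by (simp add: unitary_mat_def mat_def)
  finally show ?thesis
    using of_real_eq_iff by blast
qed

lemma conjugated_real_diag_entry:
  "(W ** real_diag d ** cadjoint W) $ i $ i
    = of_real (\<Sum>j\<in>UNIV. (cmod (W $ i $ j))\<^sup>2 * d j)"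
proof -
  have "(W ** real_diag d ** cadjoint W) $ i $ i
      = (\<Sum>j\<in>UNIV. (W ** real_diag d) $ i $ j * cnj (W $ i $ j))"
    by (simp add: matrix_matrix_mult_def[of "W ** real_diag d"] cadjoint_def)
  also have "\<dots> = (\<Sum>j\<in>UNIV. of_real ((cmod (W $ i $ j))\<^sup>2 * d j))"
    by (simp add: real_diag_mult_right mult_ac flip: complex_norm_square)
  finally show ?thesis
    by simp
qed

section \<open>Diagonalisation of Hermitian matrices\<close>

definition cdot :: "complex^'n \<Rightarrow> complex^'n \<Rightarrow> complex" where
  "cdot x y = (\<Sum>i\<in>UNIV. cnj (x $ i) * y $ i)"

lemma inner_eq_Re_cdot: "x \<bullet> y = Re (cdot x y)"
  by (simp add: cdot_def inner_vec_def inner_complex_def)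

lemma cnj_cdot: "cnj (cdot x y) = cdot y x"
  by (simp add: cdot_def mult.commute)

lemma cdot_self: "cdot x x = of_real ((norm x)\<^sup>2)"
proof -
  have "Im (cdot x x) = 0"
    by (simp add: cdot_def)
  moreover have "Re (cdot x x) = (norm x)\<^sup>2"
    by (simp add: power2_norm_eq_inner inner_eq_Re_cdot)
  ultimately show ?thesis
    by (simp add: complex_eq_iff)
qed

lemma cdot_adjoint: "cdot x (A *v y) = cdot (cadjoint A *v x) y"
proof -
  have "cdot x (A *v y) = (\<Sum>i\<in>UNIV. \<Sum>j\<in>UNIV. cnj (x $ i) * (A $ i $ j * y $ j))"
    by (simp add: cdot_def matrix_vector_mult_def sum_distrib_left)
  also have "\<dots> = (\<Sum>j\<in>UNIV. \<Sum>i\<in>UNIV. cnj (x $ i) * (A $ i $ j * y $ j))"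
    by (rule sum.swap)
  also have "\<dots> = cdot (cadjoint A *v x) y"
    by (simp add: cdot_def matrix_vector_mult_def cadjoint_def sum_distrib_left sum_distrib_right mult_ac)
  finally show ?thesis .
qed

lemma cdot_simps:
  "cdot x (y + z) = cdot x y + cdot x z"
  "cdot x (y - z) = cdot x y - cdot x z"
  "cdot x (r *\<^sub>R y) = of_real r * cdot x y"
  "cdot x (c *s y) = c * cdot x y"
  "cdot x 0 = 0"
  by (simp_all add: cdot_def algebra_simps sum.distrib sum_subtractf sum_distrib_left
      scaleR_conv_of_real[where 'a=complex])

lemma matrix_vector_mult_scaleR_complex:
  fixes A :: "complex^'n^'m"
  shows "A *v (r *\<^sub>R x) = r *\<^sub>R (A *v x)"
  by (simp add: matrix_vector_mult_def vec_eq_iff scaleR_sum_right)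

lemma continuous_on_matrix_vector_mult_complex:
  fixes A :: "complex^'n^'n"
  shows "continuous_on S (\<lambda>x. A *v x)"
  unfolding matrix_vector_mult_def by (intro continuous_intros)

text \<open>
  A maximiser \<open>x\<close> of the Rayleigh quotient on the unit sphere of the subspace is an eigenvector.
  Indeed, with the maximal value \<open>r\<close>, the quadratic form \<open>f z = r \<parallel>z\<parallel>\<^sup>2 - z \<bullet> A z\<close> is nonnegative on the
  subspace and vanishes at \<open>x\<close>; moving from \<open>x\<close> in the direction of the residual
  \<open>y = r x - A x\<close> would make it negative to first order, unless \<open>y = 0\<close>. The subspace and the inner
  product may be taken over the reals, as the eigenvalue is real.
\<close>
lemma hermitian_eigenvector_in_subspace:
  fixes A :: "complex^'n^'n"
  assumes herm: "cadjoint A = A" and S: "subspace S"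
    and inv: "\<And>x. x \<in> S \<Longrightarrow> A *v x \<in> S" and nz: "\<exists>x\<in>S. x \<noteq> 0"
  shows "\<exists>x\<in>S. \<exists>r. norm x = 1 \<and> A *v x = r *\<^sub>R x"
proof -
  define K where "K = S \<inter> sphere 0 1"
  have "compact K"
    unfolding K_def by (intro closed_Int_compact closed_subspace S compact_sphere)
  moreover obtain w where "w \<in> S" "w \<noteq> 0"
    using nz by blast
  then have "w /\<^sub>R norm w \<in> K"
    using S by (simp add: K_def subspace_scale)
  then have "K \<noteq> {}"
    by blast
  moreover have "continuous_on K (\<lambda>x. x \<bullet> (A *v x))"
    by (intro continuous_intros continuous_on_matrix_vector_mult_complex)
  ultimately obtain x where xK: "x \<in> K"
    and max: "\<And>y. y \<in> K \<Longrightarrow> y \<bullet> (A *v y) \<le> x \<bullet> (A *v x)"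
    using continuous_attains_sup[of K "\<lambda>x. x \<bullet> (A *v x)"] by blast
  have x: "x \<in> S" "norm x = 1"
    using xK by (auto simp: K_def)
  define r where "r = x \<bullet> (A *v x)"
  define f where "f z = r * (z \<bullet> z) - z \<bullet> (A *v z)" for z
  have f_nonneg: "0 \<le> f z" if "z \<in> S" for z
  proof (cases "z = 0")
    case False
    have "z /\<^sub>R norm z \<in> K"
      using S that False by (simp add: K_def subspace_scale)
    then have "(z /\<^sub>R norm z) \<bullet> (A *v (z /\<^sub>R norm z)) \<le> r"
      unfolding r_def by (rule max)
    then have "(z \<bullet> (A *v z)) / (norm z)\<^sup>2 \<le> r"
      by (simp add: matrix_vector_mult_scaleR_complex power2_eq_square divide_simps)
    then show ?thesis
      using False by (simp add: f_def divide_simps power2_norm_eq_inner split: if_splits)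
  qed (simp add: f_def)
  have fx: "f x = 0"
    using x(2) by (simp add: f_def r_def flip: power2_norm_eq_inner)
  have sym: "y \<bullet> (A *v z) = z \<bullet> (A *v y)" for y z
    by (metis cdot_adjoint cnj_cdot cnj.sel(1) herm inner_eq_Re_cdot)
  define y where "y = r *\<^sub>R x - A *v x"
  have y: "y \<in> S"
    unfolding y_def by (intro subspace_diff S subspace_scale x inv)
  have expand: "f (x + s *\<^sub>R y) = f x + 2 * s * (y \<bullet> y) + s\<^sup>2 * f y" for s
  proof -
    have "f (x + s *\<^sub>R y) = f x + 2 * s * (r * (x \<bullet> y) - y \<bullet> (A *v x)) + s\<^sup>2 * f y"
      using sym[of x y]
      by (simp add: f_def inner_add_left inner_add_right matrix_vector_right_distrib
          matrix_vector_mult_scaleR_complex inner_commute[of y x] power2_eq_square algebra_simps)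
    also have "r * (x \<bullet> y) - y \<bullet> (A *v x) = y \<bullet> y"
      by (subst (3) y_def) (simp add: y_def inner_diff_left inner_diff_right inner_commute algebra_simps)
    finally show ?thesis .
  qed
  have "y = 0"
  proof (rule ccontr)
    assume "y \<noteq> 0"
    \<comment> \<open>small enough for the linear term of \<open>f (x + s y)\<close> to dominate the quadratic one\<close>
    define s where "s = - (y \<bullet> y) / (f y + 1)"
    have fy: "0 \<le> f y"
      using y by (rule f_nonneg)
    have yy: "0 < y \<bullet> y"
      using \<open>y \<noteq> 0\<close> by simp
    have "0 \<le> f (x + s *\<^sub>R y)"
      by (intro f_nonneg subspace_add subspace_scale S x y)
    then have "0 \<le> s * (2 * (y \<bullet> y) + s * f y)"
      by (simp add: expand fx power2_eq_square algebra_simps)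
    moreover have "s < 0"
      using yy fy by (simp add: s_def divide_neg_pos)
    moreover have "2 * (y \<bullet> y) + s * f y = (y \<bullet> y) * (f y + 2) / (f y + 1)"
      using fy by (simp add: s_def field_simps)
    then have "0 < 2 * (y \<bullet> y) + s * f y"
      using fy yy by simp
    ultimately show False
      using mult_neg_pos by fastforce
  qed
  then have "A *v x = r *\<^sub>R x"
    by (simp add: y_def)
  with x show ?thesis
    by blast
qed

text \<open>
  The vectors \<open>u i\<close> with \<open>i \<in> T\<close>, conjugated, are the rows of a square matrix whose row \<open>k\<close> is zero;
  such a matrix is singular, and a vector of its kernel is orthogonal to all of them.
\<close>
lemma exists_orthogonal_vector:
  fixes u :: "'n \<Rightarrow> complex^'n"
  assumes "k \<notin> T"
  shows "\<exists>x. x \<noteq> 0 \<and> (\<forall>i\<in>T. cdot (u i) x = 0)"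
proof (rule ccontr)
  assume contra: "\<not> ?thesis"
  define M :: "complex^'n^'n" where "M = (\<chi> i j. if i \<in> T then cnj (u i $ j) else 0)"
  have M: "(M *v x) $ i = (if i \<in> T then cdot (u i) x else 0)" for x i
    by (simp add: M_def matrix_vector_mult_def cdot_def)
  have "x = 0" if "M *v x = 0" for x
    using contra M[of x] that by (metis zero_index)
  then obtain L where "L ** M = mat 1"
    using matrix_left_invertible_ker[of M] by blast
  then have "M ** L = mat 1"
    by (simp add: matrix_left_right_inverse)
  then have "(M ** L) $ k $ k = 1"
    by (simp add: mat_def)
  moreover have "(M ** L) $ k $ k = 0"
    using assms by (simp add: M_def matrix_matrix_mult_def)
  ultimately show False
    by simp
qed

lemma hermitian_orthonormal_eigenvectors:
  fixes A :: "complex^'n^'n" and T :: "'n set"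
  assumes herm: "cadjoint A = A" and "finite T"
  shows "\<exists>u d. (\<forall>i\<in>T. A *v u i = d i *\<^sub>R u i) \<and>
    (\<forall>i\<in>T. \<forall>j\<in>T. cdot (u i) (u j) = (if i = j then 1 else 0))"
  using \<open>finite T\<close>
proof induction
  case empty
  show ?case by simp
next
  case (insert k T)
  then obtain u d where ev: "\<And>i. i \<in> T \<Longrightarrow> A *v u i = d i *\<^sub>R u i"
    and on: "\<And>i j. i \<in> T \<Longrightarrow> j \<in> T \<Longrightarrow> cdot (u i) (u j) = (if i = j then 1 else 0)"
    by blast
  \<comment> \<open>the orthogonal complement of the eigenvectors found so far, which \<open>A\<close> leaves invariant\<close>
  define S where "S = {x. \<forall>i\<in>T. cdot (u i) x = 0}"
  have "subspace S"
    by (auto simp: S_def subspace_def cdot_simps)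
  moreover have "A *v x \<in> S" if "x \<in> S" for x
  proof -
    have "cdot (u i) (A *v x) = 0" if "i \<in> T" for i
    proof -
      have "cdot (u i) (A *v x) = cdot (d i *\<^sub>R u i) x"
        using that by (simp add: cdot_adjoint herm ev)
      also have "\<dots> = cnj (of_real (d i) * cdot x (u i))"
        by (metis cnj_cdot cdot_simps(3))
      also have "\<dots> = 0"
        using \<open>x \<in> S\<close> that by (simp add: cnj_cdot S_def)
      finally show ?thesis .
    qed
    then show ?thesis by (simp add: S_def)
  qed
  moreover have "\<exists>x\<in>S. x \<noteq> 0"
    using exists_orthogonal_vector[OF insert.hyps(2), of u] by (auto simp: S_def)
  ultimately obtain x r where x: "x \<in> S" "norm x = 1" "A *v x = r *\<^sub>R x"
    using hermitian_eigenvector_in_subspace[OF herm, of S] by blast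
  have ux: "cdot (u i) x = 0" "cdot x (u i) = 0" if "i \<in> T" for i
    using x(1) that cnj_cdot[of "u i" x] by (auto simp: S_def)
  have "cdot x x = 1"
    using x(2) by (simp add: cdot_self)
  with ux x(3) ev on insert.hyps(2) show ?case
    by (intro exI[of _ "u(k := x)"] exI[of _ "d(k := r)"]) auto
qed

lemma hermitian_diagonalisable:
  fixes A :: "complex^'n^'n"
  assumes "cadjoint A = A"
  obtains U d where "unitary_mat U" and "A = U ** real_diag d ** cadjoint U"
proof -
  obtain u :: "'n \<Rightarrow> complex^'n" and d where ev: "\<And>i. A *v u i = d i *\<^sub>R u i"
    and on: "\<And>i j. cdot (u i) (u j) = (if i = j then 1 else 0)"
    using hermitian_orthonormal_eigenvectors[OF assms, of UNIV] by auto
  define U :: "complex^'n^'n" where "U = (\<chi> i j. u j $ i)"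
  have "cadjoint U ** U = mat 1"
    using on by (simp add: vec_eq_iff matrix_matrix_mult_def cadjoint_def U_def mat_def cdot_def)
  then have U: "unitary_mat U"
    using matrix_left_right_inverse by (auto simp: unitary_mat_def)
  have "(A ** U) $ i $ j = (A *v u j) $ i" for i j
    by (simp add: matrix_matrix_mult_def matrix_vector_mult_def U_def)
  then have "A ** U = U ** real_diag d"
    by (simp add: vec_eq_iff real_diag_mult_right ev U_def
        scaleR_conv_of_real[where 'a=complex] mult.commute)
  then have "A = U ** real_diag d ** cadjoint U"
    using U by (metis matrix_mul_assoc matrix_mul_rid unitary_mat_def)
  with U show ?thesis
    by (rule that)
qed

lemma psd_diagonalisable:
  fixes A :: "complex^'n^'n"
  assumes "psd A"
  obtains U d where "unitary_mat U" and "A = U ** real_diag d ** cadjoint U" and "\<And>i. 0 \<le> d i"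
proof -
  obtain U d where U: "unitary_mat U" and A: "A = U ** real_diag d ** cadjoint U"
    using assms hermitian_diagonalisable by (metis psd_def)
  \<comment> \<open>an eigenvalue is the value of the quadratic form at its column of \<open>U\<close>\<close>
  have "0 \<le> d k" for k
  proof -
    have AU: "A ** U = U ** real_diag d"
      using U by (simp add: A unitary_mat_def flip: matrix_mul_assoc)
    define x where "x = (\<chi> i. U $ i $ k)"
    have "A *v x = of_real (d k) *s x"
    proof -
      have "(A *v x) $ i = (A ** U) $ i $ k" for i
        by (simp add: matrix_vector_mult_def matrix_matrix_mult_def x_def)
      then show ?thesis
        by (simp add: vec_eq_iff AU real_diag_mult_right x_def mult.commute)
    qed
    moreover have "cdot x x = 1"
    proof -
      have "cdot x x = (cadjoint U ** U) $ k $ k"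
        by (simp add: cdot_def x_def matrix_matrix_mult_def cadjoint_def)
      with U show ?thesis
        by (simp add: unitary_mat_def mat_def)
    qed
    ultimately have "cdot x (A *v x) = of_real (d k)"
      by (simp add: cdot_simps)
    then show ?thesis
      using assms by (metis psd_def cdot_def Re_complex_of_real)
  qed
  with U A show ?thesis
    by (rule that)
qed

section \<open>Symmetric norms and diagonals\<close>

lemma symmetric_norm_add: "symmetric_norm N \<Longrightarrow> N (X + Y) \<le> N X + N Y"
  by (simp add: symmetric_norm_def)

lemma symmetric_norm_scaleR:
  assumes "symmetric_norm N"
  shows "N (r *\<^sub>R X) = \<bar>r\<bar> * N X"
proof -
  have "r *\<^sub>R X = (\<chi> i j. of_real r * X $ i $ j)"
    by (simp add: vec_eq_iff scaleR_conv_of_real[where 'a=complex])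
  with assms show ?thesis
    by (simp add: symmetric_norm_def)
qed

lemma symmetric_norm_unitary:
  assumes "symmetric_norm N" and "unitary_mat U" and "unitary_mat V"
  shows "N (U ** X ** V) = N X"
  using assms by (simp add: symmetric_norm_def)

lemma symmetric_norm_convex_combination:
  assumes N: "symmetric_norm N" and "0 \<le> r" "0 \<le> s" "r + s = 1" and "N X \<le> c" "N Y \<le> c"
  shows "N (r *\<^sub>R X + s *\<^sub>R Y) \<le> c"
proof -
  have "N (r *\<^sub>R X + s *\<^sub>R Y) \<le> r * N X + s * N Y"
    using symmetric_norm_add[OF N, of "r *\<^sub>R X" "s *\<^sub>R Y"] assms
    by (simp add: symmetric_norm_scaleR)
  also have "\<dots> \<le> c"
    using assms by (intro convex_bound_le) auto
  finally show ?thesis .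
qed

definition sign_flip :: "'n \<Rightarrow> complex^'n^'n" where
  "sign_flip k = real_diag (\<lambda>i. if i = k then -1 else 1)"

lemma unitary_sign_flip: "unitary_mat (sign_flip k)"
proof -
  have "cadjoint (sign_flip k) = sign_flip k"
    by (auto simp: vec_eq_iff cadjoint_def sign_flip_def real_diag_def)
  moreover have "sign_flip k ** sign_flip k = mat 1"
    by (auto simp: vec_eq_iff sign_flip_def real_diag_mult_left) (auto simp: real_diag_def mat_def)
  ultimately show ?thesis
    by (simp add: unitary_mat_def)
qed

text \<open>
  Averaging a matrix with its conjugate by a sign flip at \<open>k\<close> deletes the off-diagonal entries of row
  and column \<open>k\<close>. Doing this for each \<open>k \<in> T\<close> never increases the norm, and \<open>T = UNIV\<close> leaves the
  diagonal part.
\<close>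
lemma symmetric_norm_pinching:
  fixes M :: "complex^'n^'n"
  assumes N: "symmetric_norm N" and "finite T"
  shows "N (\<chi> i j. if i = j \<or> i \<notin> T \<and> j \<notin> T then M $ i $ j else 0) \<le> N M"
  using \<open>finite T\<close>
proof induction
  case empty
  show ?case by simp
next
  case (insert k T)
  let ?P = "\<lambda>T. (\<chi> i j. if i = j \<or> i \<notin> T \<and> j \<notin> T then M $ i $ j else 0) :: complex^'n^'n"
  let ?F = "sign_flip k ** ?P T ** sign_flip k"
  have "?P (insert k T) = (1/2) *\<^sub>R ?P T + (1/2) *\<^sub>R ?F"
    by (auto simp: vec_eq_iff sign_flip_def real_diag_mult_left real_diag_mult_right)
  moreover have "N ?F \<le> N M"
    using insert.IH N by (simp add: symmetric_norm_unitary unitary_sign_flip)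
  ultimately show ?case
    using symmetric_norm_convex_combination[OF N, of "1/2" "1/2" "?P T" "N M" ?F] insert.IH
    by simp
qed

text \<open>
  The coordinates in \<open>T\<close> are lowered from \<open>y\<close> to \<open>x\<close> one at a time: multiplying one coordinate by
  \<open>r \<in> [0, 1]\<close> gives a convex combination, with weights \<open>(1 + r) / 2\<close> and \<open>(1 - r) / 2\<close>, of the
  matrix and the same matrix with the sign of that coordinate changed.
\<close>
lemma symmetric_norm_real_diag_mono:
  fixes x y :: "'n::finite \<Rightarrow> real"
  assumes N: "symmetric_norm (N :: complex^'n^'n \<Rightarrow> real)" and "finite T"
    and xy: "\<And>i. 0 \<le> x i \<and> x i \<le> y i"
  shows "N (real_diag (\<lambda>i. if i \<in> T then x i else y i)) \<le> N (real_diag y)"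
  using \<open>finite T\<close>
proof induction
  case empty
  show ?case by simp
next
  case (insert k T)
  let ?D = "real_diag (\<lambda>i. if i \<in> T then x i else y i) :: complex^'n^'n"
  \<comment> \<open>if \<open>y k = 0\<close> then \<open>x k = 0\<close> too, and any ratio will do\<close>
  define r where "r = (if y k = 0 then 1 else x k / y k)"
  have xk: "x k = r * y k" and r: "0 \<le> r" "r \<le> 1"
    using xy[of k] by (auto simp: r_def divide_simps)
  have "real_diag (\<lambda>i. if i \<in> insert k T then x i else y i)
      = ((1 + r) / 2) *\<^sub>R ?D + ((1 - r) / 2) *\<^sub>R (sign_flip k ** ?D ** mat 1)"
    using insert.hyps xk
    by (auto simp: vec_eq_iff sign_flip_def real_diag_mult_left)
      (auto simp: real_diag_def scaleR_conv_of_real[where 'a=complex] field_simps)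
  moreover have "N (sign_flip k ** ?D ** mat 1) = N ?D"
    by (rule symmetric_norm_unitary[OF N unitary_sign_flip unitary_mat_1])
  ultimately show ?case
    using symmetric_norm_convex_combination[OF N, of "(1+r)/2" "(1-r)/2" ?D "N (real_diag y)"
        "sign_flip k ** ?D ** mat 1"] insert.IH r
    by (simp add: field_simps)
qed

lemma symmetric_norm_real_diag_le:
  fixes M :: "complex^'n^'n"
  assumes N: "symmetric_norm N"
    and M: "\<And>i. M $ i $ i = of_real (y i)" and xy: "\<And>i. 0 \<le> x i \<and> x i \<le> y i"
  shows "N (real_diag x) \<le> N M"
proof -
  have "N (real_diag x) \<le> N (real_diag y)"
    using symmetric_norm_real_diag_mono[where T = UNIV, OF N _ xy] by simp
  also have "real_diag y = (\<chi> i j. if i = j \<or> i \<notin> UNIV \<and> j \<notin> UNIV then M $ i $ j else 0)"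
    by (simp add: real_diag_def vec_eq_iff M)
  also have "N \<dots> \<le> N M"
    by (intro symmetric_norm_pinching[OF N]) simp
  finally show ?thesis .
qed

section \<open>The reverse Hoelder inequality\<close>

text \<open>
  The condition on \<open>q\<close> makes the powers of \<open>l\<close> cancel in \<open>(a l)\<^sup>p (l\<^sup>q)\<^bsup>1-p\<^esup> = a\<^sup>p\<close>, so this is
  Young's inequality for \<open>a l / \<alpha>\<close> and \<open>l\<^sup>q / \<beta>\<close> with weights \<open>p\<close> and \<open>1 - p\<close>. The left-hand side is
  independent of \<open>l\<close>, which allows averaging over the eigenvalues of \<open>B\<close>; the scaling by \<open>\<alpha>\<close> and
  \<open>\<beta>\<close> makes the two terms contribute \<open>p\<close> and \<open>1 - p\<close> after norms are taken.
\<close>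
lemma reverse_young:
  fixes p q :: real
  assumes p: "0 < p" "p < 1" and q: "p + q * (1 - p) = 0"
    and "0 \<le> a" "0 < l" "0 < \<alpha>" "0 < \<beta>"
  shows "a powr p \<le> \<alpha> powr p * \<beta> powr (1 - p) * (p / \<alpha> * (a * l) + (1 - p) / \<beta> * l powr q)"
proof (cases "a = 0")
  case True
  with assms show ?thesis
    by simp
next
  case False
  with \<open>0 \<le> a\<close> have "0 < a"
    by simp
  have "l powr p * l powr (q * (1 - p)) = 1"
    using \<open>0 < l\<close> by (simp add: q flip: powr_add)
  then have "(a * l / \<alpha>) powr p * (l powr q / \<beta>) powr (1 - p)
      = a powr p / (\<alpha> powr p * \<beta> powr (1 - p))"
    using assms by (simp add: powr_divide powr_mult powr_powr)
  moreover have "(a * l / \<alpha>) powr p * (l powr q / \<beta>) powr (1 - p)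
      \<le> p * (a * l / \<alpha>) + (1 - p) * (l powr q / \<beta>)"
    using assms \<open>0 < a\<close> by (intro Youngs_inequality_0) auto
  ultimately have "a powr p / (\<alpha> powr p * \<beta> powr (1 - p))
      \<le> p * (a * l / \<alpha>) + (1 - p) * (l powr q / \<beta>)"
    by simp
  then show ?thesis
    using assms by (simp add: field_simps)
qed

theorem proposition6p9:
  fixes N :: "complex^'n^'n \<Rightarrow> real" and A B :: "complex^'n^'n" and p q :: real
  assumes "symmetric_norm N"
    and "0 < p" and "p < 1" and "q < 0" and "1 / p + 1 / q = 1"
    and "psd A" and "psd B"
  shows "N (A ** B) \<ge> N (psd_powr A p) powr (1 / p) * power_functional N q B"
proof (cases "invertible B")
  case False
  with assms(1,4) show ?thesis
    by (simp add: power_functional_def symmetric_norm_def)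
next
  case True
  note N = assms(1)
  have N0: "0 \<le> N X" "N X = 0 \<longleftrightarrow> X = 0" for X
    using N by (auto simp: symmetric_norm_def)
  have pq: "p + q * (1 - p) = 0" and q_inv: "1 / q = - ((1 - p) / p)"
    using assms(2-5) by (auto simp: field_simps)
  obtain U a where U: "unitary_mat U" and A: "A = U ** real_diag a ** cadjoint U"
    and a: "\<And>i. 0 \<le> a i"
    using psd_diagonalisable[OF assms(6)] by blast
  obtain V b where V: "unitary_mat V" and B: "B = V ** real_diag b ** cadjoint V"
    and b0: "\<And>i. 0 \<le> b i"
    using psd_diagonalisable[OF assms(7)] by blast
  have b: "0 < b j" for j
  proof (rule ccontr)
    assume "\<not> 0 < b j"
    then have "b j = 0"
      using b0[of j] by simp
    obtain B' where "B ** B' = mat 1"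
      using \<open>invertible B\<close> by (auto simp: invertible_def)
    have "real_diag b ** (cadjoint V ** B' ** V) = cadjoint V ** (B ** B') ** V"
      using V by (simp add: B unitary_mat_cancel flip: matrix_mul_assoc)
    also have "\<dots> = mat 1"
      using V by (simp add: \<open>B ** B' = mat 1\<close> unitary_mat_def)
    finally have "real_diag b ** (cadjoint V ** B' ** V) = mat 1" .
    then have "(real_diag b ** (cadjoint V ** B' ** V)) $ j $ j = 1"
      by (simp add: mat_def)
    then show False
      using \<open>b j = 0\<close> by (simp add: real_diag_mult_left)
  qed
  define W where "W = cadjoint U ** V"
  have W: "unitary_mat W"
    using U V by (simp add: W_def unitary_mat_mult unitary_mat_cadjoint)
  define \<alpha> where "\<alpha> = N (A ** B)"
  define \<beta> where "\<beta> = N (psd_powr B q)"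
  \<comment> \<open>\<open>C\<close> and \<open>D\<close> are \<open>B\<close> and its \<open>q\<close>-th power in the eigenbasis of \<open>A\<close>\<close>
  define C where "C = W ** real_diag b ** cadjoint W"
  define D where "D = W ** real_diag (\<lambda>j. b j powr q) ** cadjoint W"
  have NA: "N (psd_powr A p) = N (real_diag (\<lambda>i. a i powr p))"
    using herm_fun_diag[OF U A] N U
    by (simp add: psd_powr_def symmetric_norm_unitary unitary_mat_cadjoint)
  have Bq: "psd_powr B q = U ** D ** cadjoint U"
    using herm_fun_diag[OF V B] U
    by (simp add: psd_powr_def D_def W_def cadjoint_mult unitary_mat_cancel flip: matrix_mul_assoc)
  have ND: "N D = \<beta>"
    using N U by (simp add: \<beta>_def Bq symmetric_norm_unitary unitary_mat_cadjoint)
  have AB: "A ** B = U ** (real_diag a ** C) ** cadjoint U"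
    using U by (simp add: A B C_def W_def cadjoint_mult unitary_mat_cancel flip: matrix_mul_assoc)
  have NC: "N (real_diag a ** C) = \<alpha>"
    using N U by (simp add: \<alpha>_def AB symmetric_norm_unitary unitary_mat_cadjoint)
  have \<beta>_pos: "0 < \<beta>"
  proof -
    fix i
    have "D $ i $ i = of_real (\<Sum>j\<in>UNIV. (cmod (W $ i $ j))\<^sup>2 * b j powr q)"
      by (simp add: D_def conjugated_real_diag_entry)
    moreover have "(\<Sum>j\<in>UNIV. (cmod (W $ i $ j))\<^sup>2 * b j powr q) \<noteq> 0"
    proof
      assume "(\<Sum>j\<in>UNIV. (cmod (W $ i $ j))\<^sup>2 * b j powr q) = 0"
      then have "\<forall>j. (cmod (W $ i $ j))\<^sup>2 = 0"
        using b by (subst (asm) sum_nonneg_eq_0_iff) (auto simp: less_imp_neq[symmetric])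
      then show False
        using unitary_mat_row_norm[OF W, of i] by simp
    qed
    ultimately have "D \<noteq> 0"
      by (metis of_real_eq_0_iff zero_index)
    then show ?thesis
      using N0[of D] ND by simp
  qed
  have main: "N (psd_powr A p) \<le> \<alpha> powr p * \<beta> powr (1 - p)"
  proof (cases "\<alpha> = 0")
    \<comment> \<open>then \<open>A = 0\<close>, as \<open>B\<close> is invertible, and \<open>A\<^sup>p = 0\<close> because \<open>0 powr p = 0\<close>\<close>
    case True
    then have "A ** B = 0"
      using N0 by (simp add: \<alpha>_def)
    moreover obtain B' where "B ** B' = mat 1"
      using \<open>invertible B\<close> by (auto simp: invertible_def)
    moreover have "A = A ** B ** B'"
      by (simp add: \<open>B ** B' = mat 1\<close> flip: matrix_mul_assoc)
    ultimately have "A = 0"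
      by (simp add: matrix_matrix_mult_def vec_eq_iff)
    moreover have "cadjoint U ** A ** U = real_diag a"
      using U by (simp add: A unitary_mat_cancel flip: matrix_mul_assoc)
    ultimately have diag_0: "(real_diag a :: complex^'n^'n) = 0"
      by simp
    have "a i = 0" for i
    proof -
      have "(real_diag a :: complex^'n^'n) $ i $ i = 0"
        by (simp add: diag_0)
      then show ?thesis
        by (simp add: real_diag_def)
    qed
    then have "real_diag (\<lambda>i. a i powr p) = (0 :: complex^'n^'n)"
      by (simp add: real_diag_def vec_eq_iff)
    then show ?thesis
      using N0(2)[of 0] NA True by simp
  next
    case False
    then have \<alpha>_pos: "0 < \<alpha>"
      using N0(1)[of "A ** B"] by (simp add: \<alpha>_def)
    define c where "c = \<alpha> powr p * \<beta> powr (1 - p)"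
    define M where "M = c *\<^sub>R ((p / \<alpha>) *\<^sub>R (real_diag a ** C) + ((1 - p) / \<beta>) *\<^sub>R D)"
    \<comment> \<open>the diagonal of \<open>M\<close>, as an average of the right-hand sides of \<open>reverse_young\<close>\<close>
    define y where "y i = (\<Sum>j\<in>UNIV. (cmod (W $ i $ j))\<^sup>2 *
        (c * (p / \<alpha> * (a i * b j) + (1 - p) / \<beta> * b j powr q)))" for i
    have My: "M $ i $ i = of_real (y i)" for i
    proof -
      have "y i = c * (p / \<alpha> * (a i * (\<Sum>j\<in>UNIV. (cmod (W $ i $ j))\<^sup>2 * b j))
          + (1 - p) / \<beta> * (\<Sum>j\<in>UNIV. (cmod (W $ i $ j))\<^sup>2 * b j powr q))"
        by (simp add: y_def sum_distrib_left sum.distrib algebra_simps)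
      then show ?thesis
        by (simp add: M_def C_def D_def real_diag_mult_left conjugated_real_diag_entry
            scaleR_conv_of_real[where 'a=complex])
    qed
    have "a i powr p \<le> y i" for i
    proof -
      have "a i powr p = (\<Sum>j\<in>UNIV. (cmod (W $ i $ j))\<^sup>2 * a i powr p)"
        by (simp add: unitary_mat_row_norm[OF W] flip: sum_distrib_right)
      also have "\<dots> \<le> y i"
        unfolding y_def c_def using assms(2,3) a b \<alpha>_pos \<beta>_pos pq
        by (intro sum_mono mult_left_mono reverse_young) auto
      finally show ?thesis .
    qed
    then have "N (real_diag (\<lambda>i. a i powr p)) \<le> N M"
      by (intro symmetric_norm_real_diag_le[OF N My]) simp
    also have "\<dots> \<le> c * (p / \<alpha> * \<alpha> + (1 - p) / \<beta> * \<beta>)"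
    proof -
      have "N ((p / \<alpha>) *\<^sub>R (real_diag a ** C) + ((1 - p) / \<beta>) *\<^sub>R D)
          \<le> p / \<alpha> * \<alpha> + (1 - p) / \<beta> * \<beta>"
        using symmetric_norm_add[OF N, of "(p / \<alpha>) *\<^sub>R (real_diag a ** C)" "((1 - p) / \<beta>) *\<^sub>R D"]
          assms(2,3) \<alpha>_pos \<beta>_pos
        by (simp add: symmetric_norm_scaleR[OF N] NC ND)
      then show ?thesis
        unfolding M_def symmetric_norm_scaleR[OF N]
        by (simp add: c_def mult_left_mono)
    qed
    also have "\<dots> = c"
      using \<alpha>_pos \<beta>_pos by simp
    finally show ?thesis
      by (simp add: NA c_def)
  qed
  have "N (psd_powr A p) powr (1 / p) \<le> (\<alpha> powr p * \<beta> powr (1 - p)) powr (1 / p)"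
    using main N0(1) assms(2) by (intro powr_mono2) auto
  also have "\<dots> = \<alpha> * \<beta> powr ((1 - p) / p)"
    using assms(2) N0(1)[of "A ** B"] by (simp add: powr_mult powr_powr \<alpha>_def)
  finally have "N (psd_powr A p) powr (1 / p) * \<beta> powr (1 / q)
      \<le> \<alpha> * \<beta> powr ((1 - p) / p) * \<beta> powr (1 / q)"
    by (intro mult_right_mono) auto
  also have "\<dots> = \<alpha>"
    using \<beta>_pos by (simp only: q_inv powr_minus) simp
  finally show ?thesis
    using True by (simp add: power_functional_def \<alpha>_def \<beta>_def)
qed

end
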